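(* Let $G=(V,E)$ be a finite simple graph with integer node weights $w\in\mathbb{N}^V$ and edge weights satisfying $w_{ij}\ge\max\{w_i,w_j\}$ for all edges $ij\in E$. Then $$\mathrm{rk}_H(G,w)\le 2\big(\alpha^*(G,w)-\alpha(G,w)\big)+2.$$
   Context: Let $V=[n]$. $\alpha(G,w)$ is the maximum of $w(S)=\sum_{i\in S}w_i$ over stable sets $S$ of $G$. The fractional stability number is $\alpha^*(G,w)=\max\{w^Tx: x\in\mathrm{FR}(G)\}$, where $\mathrm{FR}(G)=\{x\in\mathbb{R}^V: x\ge 0,\ x_i+x_j\le 1\ \forall ij\in E\}$; if $G$ has isolated nodes, the constraint $x_i\le 1$ for these nodes is understood as well. For $I\subseteq V$ write $x^I=\prod_{i\in I}x_i$ and $(1-x)^I=\prod_{i\in I}(1-x_i)$. For an integer $t\ge 1$, $$H_t=\Big\{\sum_{T\subseteq V,\ |T|\le t}\ \sum_{I\subseteq T}c_{T,I}\,x^I(1-x)^{T\setminus I}:\ c_{T,I}\ge 0\Big\}\subseteq\mathbb{R}[x_1,\dots,x_n].$$ Set $p_{G,w}=\sum_{i\in V}w_ix_i-\sum_{ij\in E}w_{ij}x_ix_j$ and $p_{\mathrm{han}}^{(t)}(G,w)=\inf\{\lambda\in\mathbb{R}:\lambda-p_{G,w}\in H_t\}$. The Handelman rank $\mathrm{rk}_H(G,w)$ is the smallest integer $t\ge1$ for which $p_{\mathrm{han}}^{(t)}(G,w)=\alpha(G,w)$; equivalently, the smallest $t$ for which $\alpha(G,w)-p_{G,w}\in H_t$.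 *)

theory Defs
  imports Complex_Main "HOL-Library.Poly_Mapping" "HOL-Library.Extended_Real"
begin

definition finite_simple_graph :: "'a set \<Rightarrow> 'a set set \<Rightarrow> bool" where
  "finite_simple_graph V E \<longleftrightarrow> finite V \<and> (\<forall>e\<in>E. e \<subseteq> V \<and> card e = 2)"

definition stable_sets :: "'a set \<Rightarrow> 'a set set \<Rightarrow> 'a set set" where
  "stable_sets V E = {S. S \<subseteq> V \<and> (\<forall>e\<in>E. \<not> e \<subseteq> S)}"

definition stability_number :: "'a set \<Rightarrow> 'a set set \<Rightarrow> ('a \<Rightarrow> nat) \<Rightarrow> nat" where
  "stability_number V E w = Max ((\<lambda>S. \<Sum>i\<in>S. w i) ` stable_sets V E)"

text \<open>Vectors indexed by \<open>V\<close> are functions of which only the values on \<open>V\<close> matter.\<close>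

definition FR :: "'a set \<Rightarrow> 'a set set \<Rightarrow> ('a \<Rightarrow> real) set" where
  "FR V E = {x. (\<forall>i\<in>V. 0 \<le> x i)
              \<and> (\<forall>i j. {i, j} \<in> E \<longrightarrow> x i + x j \<le> 1)
              \<and> (\<forall>i\<in>V. (\<forall>e\<in>E. i \<notin> e) \<longrightarrow> x i \<le> 1)}"

text \<open>The maximum of a linear function over the (compact, nonempty) polytope is its supremum.\<close>

definition fractional_stability_number :: "'a set \<Rightarrow> 'a set set \<Rightarrow> ('a \<Rightarrow> nat) \<Rightarrow> real" where
  "fractional_stability_number V E w = (SUP x\<in>FR V E. \<Sum>i\<in>V. real (w i) * x i)"

text \<open>Real polynomials in commuting variables indexed by \<open>'a\<close>: finitely supported maps from
  monomials (exponent vectors) to coefficients.\<close>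

type_synonym 'a rpoly = "('a \<Rightarrow>\<^sub>0 nat) \<Rightarrow>\<^sub>0 real"

definition Const :: "real \<Rightarrow> 'a rpoly" where
  "Const c = Poly_Mapping.single 0 c"

definition Var :: "'a \<Rightarrow> 'a rpoly" where
  "Var i = Poly_Mapping.single (Poly_Mapping.single i 1) 1"

definition handelman_set :: "'a set \<Rightarrow> nat \<Rightarrow> 'a rpoly set" where
  "handelman_set V t =
     {(\<Sum>T\<in>{T. T \<subseteq> V \<and> card T \<le> t}. \<Sum>I\<in>Pow T.
         Const (c T I) * (\<Prod>i\<in>I. Var i) * (\<Prod>i\<in>T - I. 1 - Var i))
      | c :: 'a set \<Rightarrow> 'a set \<Rightarrow> real. \<forall>T I. 0 \<le> c T I}"

definition graph_poly :: "'a set \<Rightarrow> 'a set set \<Rightarrow> ('a \<Rightarrow> nat) \<Rightarrow> ('a set \<Rightarrow> real) \<Rightarrow> 'a rpoly" where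
  "graph_poly V E w u =
     (\<Sum>i\<in>V. Const (real (w i)) * Var i) - (\<Sum>e\<in>E. Const (u e) * (\<Prod>i\<in>e. Var i))"

text \<open>Extended reals, because the set of feasible \<open>l\<close> may be empty for small \<open>t\<close>;
  the bound is then \<open>\<infinity>\<close>.\<close>

definition p_han ::
    "'a set \<Rightarrow> 'a set set \<Rightarrow> ('a \<Rightarrow> nat) \<Rightarrow> ('a set \<Rightarrow> real) \<Rightarrow> nat \<Rightarrow> ereal" where
  "p_han V E w u t =
     (INF l\<in>{l :: real. Const l - graph_poly V E w u \<in> handelman_set V t}. ereal l)"

text \<open>The rank is \<open>\<infinity>\<close> if no level of the hierarchy is exact.\<close>

definition handelman_rank ::
    "'a set \<Rightarrow> 'a set set \<Rightarrow> ('a \<Rightarrow> nat) \<Rightarrow> ('a set \<Rightarrow> real) \<Rightarrow> enat" where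
  "handelman_rank V E w u =
     (INF t\<in>{t. 1 \<le> t \<and> p_han V E w u t = ereal (real (stability_number V E w))}. enat t)"

end

(* Call (X, Y) cross-stable if no edge joins a node of X to a node of Y; the half-integral point
   (1_X + 1_Y)/2 then lies in FR, so w(X) + w(Y) <= k for the floor k of twice the fractional
   stability number.  The claim "alpha(G[W]) <= l and w(X) + w(Y) <= k for all cross-stable pairs in W
   imply l - p in H_(k - 2l + 2)" is proved by induction on W.
   If k <= 2l, weighted Konig duality on the bipartite double cover yields an edge weighting that
   writes l - p as a nonnegative combination of terms (1 - x_i)(1 - x_j), 1 - x_i and x_i x_j.
   Otherwise consider the tight pairs (w(X) + w(Y) = k) with Y contained in X; uncrossing (X, Y) with
   (Y, X) produces such a pair from every tight pair.  If one of them has X - Y different from W, the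
   problem splits: X - Y is handled by induction, and on the rest w(Y) is an exact half-integral bound.
   If all of them are (W, {}), then deleting any node i, or fixing x_i = 1, strictly decreases k,
   and l - p = x_i (l - p)|x_i=1 + (1 - x_i) (l - p)|x_i=0 costs one level of the hierarchy. *)
theory Submission
  imports Defs
begin

section \<open>Weighted Konig duality in bipartite graphs\<close>

text \<open>An edge cover with multiplicities, made exact: \<open>f\<close> counts copies of edges,
  \<open>g\<close> and \<open>h\<close> count single nodes used to fill up, and every node is
  covered precisely as often as its weight. Exactness later turns a cover into identities between
  linear forms.\<close>

definition konig_cover ::
  "'a set \<Rightarrow> 'b set \<Rightarrow> ('a \<Rightarrow> 'b \<Rightarrow> bool) \<Rightarrow> ('a \<Rightarrow> nat) \<Rightarrow> ('b \<Rightarrow> nat) \<Rightarrow>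
   ('a \<Rightarrow> 'b \<Rightarrow> nat) \<Rightarrow> ('a \<Rightarrow> nat) \<Rightarrow> ('b \<Rightarrow> nat) \<Rightarrow> bool" where
  "konig_cover A B R a b f g h \<longleftrightarrow>
     (\<forall>x y. f x y \<noteq> 0 \<longrightarrow> R x y) \<and>
     (\<forall>x\<in>A. a x = g x + (\<Sum>y\<in>B. f x y)) \<and>
     (\<forall>y\<in>B. b y = h y + (\<Sum>x\<in>A. f x y))"

text \<open>These are the stable sets of the bipartite graph \<open>R\<close>, given by their two
  sides. For \<open>R = adj\<close> that graph is the bipartite double cover.\<close>

definition cross_stable :: "('a \<Rightarrow> 'b \<Rightarrow> bool) \<Rightarrow> 'a set \<Rightarrow> 'b set \<Rightarrow> bool" where
  "cross_stable R X Y \<longleftrightarrow> (\<forall>x\<in>X. \<forall>y\<in>Y. \<not> R x y)"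

lemma sum_fun_upd_decr:
  fixes a :: "'a \<Rightarrow> nat"
  assumes "finite X" "0 < a x"
  shows "sum a X = sum (a(x := a x - 1)) X + (if x \<in> X then 1 else 0)"
proof (cases "x \<in> X")
  case True
  then show ?thesis using assms by (simp add: sum.remove[of X x])
next
  case False
  then have "sum (a(x := a x - 1)) X = sum a X" by (intro sum.cong) auto
  then show ?thesis using False by simp
qed

text \<open>Weight is modular: the two uncrossed pairs together weigh \<open>2 * k\<close>. Both are
  cross-stable, hence weigh at most \<open>k\<close>, so neither falls short.\<close>

lemma cross_stable_uncross:
  fixes a :: "'a \<Rightarrow> nat" and b :: "'b \<Rightarrow> nat"
  assumes fin: "finite A" "finite B"
    and bound: "\<And>X Y. X \<subseteq> A \<Longrightarrow> Y \<subseteq> B \<Longrightarrow> cross_stable R X Y \<Longrightarrow> sum a X + sum b Y \<le> k"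
    and 1: "X \<subseteq> A" "Y \<subseteq> B" "cross_stable R X Y" "sum a X + sum b Y = k"
    and 2: "X' \<subseteq> A" "Y' \<subseteq> B" "cross_stable R X' Y'" "sum a X' + sum b Y' = k"
  shows "cross_stable R (X \<union> X') (Y \<inter> Y')" "sum a (X \<union> X') + sum b (Y \<inter> Y') = k"
proof -
  have c: "cross_stable R (X \<union> X') (Y \<inter> Y')" "cross_stable R (X \<inter> X') (Y \<union> Y')"
    using 1(3) 2(3) by (auto simp: cross_stable_def)
  have "sum a (X \<union> X') + sum b (Y \<inter> Y') \<le> k" by (rule bound) (use 1 2 c in auto)
  moreover have "sum a (X \<inter> X') + sum b (Y \<union> Y') \<le> k" by (rule bound) (use 1 2 c in auto)
  moreover have "sum a (X \<union> X') + sum a (X \<inter> X') = sum a X + sum a X'"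
    by (rule sum.union_inter) (use 1 2 fin finite_subset in auto)
  moreover have "sum b (Y \<union> Y') + sum b (Y \<inter> Y') = sum b Y + sum b Y'"
    by (rule sum.union_inter) (use 1 2 fin finite_subset in auto)
  ultimately show "sum a (X \<union> X') + sum b (Y \<inter> Y') = k" using 1(4) 2(4) by linarith
  show "cross_stable R (X \<union> X') (Y \<inter> Y')" by (fact c(1))
qed

text \<open>Minimum edge cover against maximum stable set, by removing the weight of
  \<open>A\<close> unit by unit. A node \<open>x\<close> of positive weight is lowered either alone
  or together with a neighbour \<open>y\<close>, in such a way that the bound drops to
  \<open>k - 1\<close>; the cover of the smaller instance then receives one more single node or
  edge.\<close>

lemma weighted_konig:
  fixes a :: "'a \<Rightarrow> nat" and b :: "'b \<Rightarrow> nat"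
  assumes fin: "finite A" "finite B"
    and bound: "\<And>X Y. X \<subseteq> A \<Longrightarrow> Y \<subseteq> B \<Longrightarrow> cross_stable R X Y \<Longrightarrow> sum a X + sum b Y \<le> k"
  shows "\<exists>f g h. konig_cover A B R a b f g h \<and>
           (\<Sum>x\<in>A. \<Sum>y\<in>B. f x y) + sum g A + sum h B \<le> k"
  using bound
proof (induction "sum a A" arbitrary: a b k)
  case 0
  then have "\<forall>x\<in>A. a x = 0" using fin by simp
  moreover have "sum a {} + sum b B \<le> k" by (rule 0) (auto simp: cross_stable_def)
  ultimately show ?case
    by (intro exI[of _ "\<lambda>_ _. 0"] exI[of _ "\<lambda>_. 0"] exI[of _ b]) (auto simp: konig_cover_def)
next
  case (Suc n)
  from Suc.hyps(2) have "sum a A \<noteq> 0" by simp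
  then obtain x where x: "x \<in> A" "0 < a x"
    by (meson gr0I sum.neutral)
  define a' where "a' = a(x := a x - 1)"
  have a_eq: "a v = a' v + (if v = x then 1 else 0)" for v
    using x by (simp add: a'_def)
  have a': "sum a X = sum a' X + (if x \<in> X then 1 else 0)" if "X \<subseteq> A" for X
    unfolding a'_def using that fin x by (intro sum_fun_upd_decr) (auto intro: finite_subset)
  have n: "n = sum a' A" using a'[of A] Suc.hyps(2) x by simp
  \<comment> \<open>Positivity of \<open>k\<close> rules out truncation in \<open>k - 1\<close>, so
    that one more unit in the cover leads back to at most \<open>k\<close>.\<close>
  have "sum a {x} + sum b {} \<le> k" by (rule Suc.prems) (use x in \<open>auto simp: cross_stable_def\<close>)
  then have k: "0 < k" using x by simp
  \<comment> \<open>The obstructions to lowering \<open>x\<close> alone: pairs of weight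
    \<open>k\<close> that do not notice the change.\<close>
  let ?tight = "\<lambda>X Y. X \<subseteq> A \<and> Y \<subseteq> B \<and> cross_stable R X Y \<and> sum a X + sum b Y = k \<and> x \<notin> X"
  show ?case
  proof (cases "\<exists>X Y. ?tight X Y")
    case False
    have "sum a' X + sum b Y \<le> k - 1" if "X \<subseteq> A" "Y \<subseteq> B" "cross_stable R X Y" for X Y
    proof (cases "x \<in> X")
      case True
      then show ?thesis using Suc.prems[OF that] a'[OF that(1)] by simp
    next
      case x: False
      then have "sum a X + sum b Y \<noteq> k" using False that by blast
      then show ?thesis using Suc.prems[OF that] a'[OF that(1)] x by simp
    qed
    from Suc.hyps(1)[OF n this] obtain f g h where
      fgh: "konig_cover A B R a' b f g h" "(\<Sum>x\<in>A. \<Sum>y\<in>B. f x y) + sum g A + sum h B \<le> k - 1"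
      by blast
    have "konig_cover A B R a b f (g(x := g x + 1)) h"
      using fgh(1) a_eq by (auto simp: konig_cover_def)
    moreover have "sum (g(x := g x + 1)) A = sum g A + 1"
      using x fin by (simp add: sum.remove)
    ultimately show ?thesis using fgh(2) k
      by (intro exI[of _ f] exI[of _ "g(x := g x + 1)"] exI[of _ h]) simp
  next
    case True
    \<comment> \<open>If each neighbour of \<open>x\<close> were missed by some tight pair,
      uncrossing these pairs one after the other would give a tight pair avoiding \<open>x\<close>
      and all its neighbours. Inserting \<open>x\<close> keeps it cross-stable and pushes its weight
      above \<open>k\<close>.\<close>
    have "\<exists>y\<in>B. R x y \<and> (\<forall>X Y. ?tight X Y \<longrightarrow> y \<in> Y)"
    proof (rule ccontr)
      assume *: "\<not> ?thesis"
      have "\<exists>X Y. ?tight X Y \<and> Y \<inter> N = {}" if "finite N" "N \<subseteq> {y\<in>B. R x y}" for N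
        using that
      proof (induction N rule: finite_induct)
        case empty
        then show ?case using True by auto
      next
        case (insert y N)
        then obtain X Y where XY: "?tight X Y" "Y \<inter> N = {}" by auto
        from insert * obtain X' Y' where XY': "?tight X' Y'" "y \<notin> Y'" by auto
        have "cross_stable R (X \<union> X') (Y \<inter> Y')" "sum a (X \<union> X') + sum b (Y \<inter> Y') = k"
          using XY(1) XY'(1) cross_stable_uncross[OF fin Suc.prems, of R X Y X' Y'] by auto
        with XY XY' show ?case
          by (intro exI[of _ "X \<union> X'"] exI[of _ "Y \<inter> Y'"]) auto
      qed
      from this[of "{y\<in>B. R x y}"] obtain X Y where
        XY: "?tight X Y" "Y \<inter> {y\<in>B. R x y} = {}" using fin by auto
      have "sum a (insert x X) + sum b Y \<le> k"
        by (rule Suc.prems) (use XY x in \<open>auto simp: cross_stable_def\<close>)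
      moreover have "sum a (insert x X) = a x + sum a X"
        using XY fin by (subst sum.insert) (auto intro: finite_subset)
      ultimately show False using XY x by simp
    qed
    then obtain y where y: "y \<in> B" "R x y" "\<And>X Y. ?tight X Y \<Longrightarrow> y \<in> Y" by blast
    \<comment> \<open>If \<open>b y\<close> were 0, removing \<open>y\<close> from a tight pair
      would keep it tight, against the choice of \<open>y\<close>.\<close>
    have yb: "0 < b y"
    proof (rule ccontr)
      assume "\<not> 0 < b y"
      obtain X Y where XY: "?tight X Y" using True by blast
      have "sum b (Y - {y}) = sum b Y"
        using XY fin \<open>\<not> 0 < b y\<close> by (intro sum.mono_neutral_left) (auto intro: finite_subset)
      then have "?tight X (Y - {y})" using XY by (auto simp: cross_stable_def)
      from y(3)[OF this] show False by simp
    qed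
    define b' where "b' = b(y := b y - 1)"
    have b': "sum b Y = sum b' Y + (if y \<in> Y then 1 else 0)" if "Y \<subseteq> B" for Y
      unfolding b'_def using that fin yb by (intro sum_fun_upd_decr) (auto intro: finite_subset)
    have b_eq: "b v = b' v + (if v = y then 1 else 0)" for v
      using yb by (simp add: b'_def)
    \<comment> \<open>A pair containing \<open>x\<close> or \<open>y\<close> loses one unit, and
      none contains both. A pair containing neither is not tight by the choice of \<open>y\<close>,
      so it lies below \<open>k\<close> already.\<close>
    have "sum a' X + sum b' Y \<le> k - 1" if "X \<subseteq> A" "Y \<subseteq> B" "cross_stable R X Y" for X Y
    proof -
      have "\<not> (x \<in> X \<and> y \<in> Y)" using that y by (auto simp: cross_stable_def)
      moreover have "x \<in> X \<or> y \<in> Y \<or> sum a X + sum b Y \<noteq> k"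
        using y(3)[of X Y] that by blast
      ultimately show ?thesis
        using Suc.prems[OF that] a'[OF that(1)] b'[OF that(2)] k
        by (auto split: if_splits)
    qed
    from Suc.hyps(1)[OF n this] obtain f g h where
      fgh: "konig_cover A B R a' b' f g h" "(\<Sum>x\<in>A. \<Sum>y\<in>B. f x y) + sum g A + sum h B \<le> k - 1"
      by blast
    define f' where "f' = (\<lambda>u v. f u v + (if u = x \<and> v = y then 1 else 0))"
    have row: "(\<Sum>v\<in>B. f' u v) = (\<Sum>v\<in>B. f u v) + (if u = x then 1 else 0)" for u
      using y fin by (cases "u = x") (simp_all add: f'_def sum.distrib)
    have col: "(\<Sum>u\<in>A. f' u v) = (\<Sum>u\<in>A. f u v) + (if v = y then 1 else 0)" for v
      using x fin by (cases "v = y") (simp_all add: f'_def sum.distrib)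
    have "konig_cover A B R a b f' g h"
      using fgh(1) y(2) unfolding konig_cover_def row col
      by (auto simp: a_eq b_eq f'_def)
    moreover have "(\<Sum>u\<in>A. \<Sum>v\<in>B. f' u v) = (\<Sum>u\<in>A. \<Sum>v\<in>B. f u v) + 1"
      unfolding row using x fin by (simp add: sum.distrib)
    ultimately show ?thesis using fgh(2) k
      by (intro exI[of _ f'] exI[of _ g] exI[of _ h]) simp
  qed
qed

section \<open>Constants and closure properties of the Handelman sets\<close>

lemma Const_0 [simp]: "Const 0 = 0" by (simp add: Const_def)
lemma Const_1 [simp]: "Const 1 = 1" by (simp add: Const_def)
lemma Const_add: "Const (a + b) = Const a + Const b" by (simp add: Const_def single_add)
lemma Const_diff: "Const (a - b) = Const a - Const b" by (simp add: Const_def single_diff)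
lemma Const_mult: "Const (a * b) = Const a * Const b" by (simp add: Const_def mult_single)
lemma Const_sum: "Const (sum f A) = (\<Sum>a\<in>A. Const (f a))"
  by (induction A rule: infinite_finite_induct) (simp_all add: Const_add)

definition handelman_monomial :: "'a set \<Rightarrow> 'a set \<Rightarrow> 'a rpoly" where
  "handelman_monomial T I = (\<Prod>i\<in>I. Var i) * (\<Prod>i\<in>T - I. 1 - Var i)"

lemma handelman_set_altdef:
  "handelman_set V t =
     {(\<Sum>T\<in>{T. T \<subseteq> V \<and> card T \<le> t}. \<Sum>I\<in>Pow T. Const (c T I) * handelman_monomial T I)
      | c. \<forall>T I. 0 \<le> c T I}"
  by (simp add: handelman_set_def handelman_monomial_def mult.assoc)

lemma handelman_set_monomial:
  assumes "finite V" "T \<subseteq> V" "card T \<le> t" "I \<subseteq> T" "0 \<le> c"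
  shows "Const c * handelman_monomial T I \<in> handelman_set V t"
proof -
  define c' where "c' T' I' = (if T' = T \<and> I' = I then c else 0)" for T' I'
  have [simp]: "finite {T. T \<subseteq> V \<and> card T \<le> t}" using assms by simp
  have "(\<Sum>I'\<in>Pow T'. Const (c' T' I') * handelman_monomial T' I')
      = (if T' = T then Const c * handelman_monomial T I else 0)" if "T' \<subseteq> V" for T'
  proof (cases "T' = T")
    case True
    have "(\<Sum>I'\<in>Pow T. Const (c' T I') * handelman_monomial T I')
        = (\<Sum>I'\<in>Pow T. if I' = I then Const c * handelman_monomial T I else 0)"
      by (intro sum.cong) (auto simp: c'_def)
    also have "\<dots> = Const c * handelman_monomial T I"
      using assms finite_subset by (subst sum.delta) auto
    finally show ?thesis using True by simp
  qed (simp add: c'_def)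
  then have "(\<Sum>T'\<in>{T. T \<subseteq> V \<and> card T \<le> t}. \<Sum>I'\<in>Pow T'. Const (c' T' I') * handelman_monomial T' I')
      = (\<Sum>T'\<in>{T. T \<subseteq> V \<and> card T \<le> t}. if T' = T then Const c * handelman_monomial T I else 0)"
    by (intro sum.cong) auto
  also have "\<dots> = Const c * handelman_monomial T I"
    using assms by (subst sum.delta) auto
  finally have *: "Const c * handelman_monomial T I =
      (\<Sum>T'\<in>{T. T \<subseteq> V \<and> card T \<le> t}. \<Sum>I'\<in>Pow T'. Const (c' T' I') * handelman_monomial T' I')" ..
  have "\<forall>T I. 0 \<le> c' T I" using assms by (simp add: c'_def)
  with * show ?thesis unfolding handelman_set_altdef by blast
qed

lemma handelman_set_add:
  assumes "p \<in> handelman_set V t" "q \<in> handelman_set V t"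
  shows "p + q \<in> handelman_set V t"
proof -
  from assms obtain c d where
    c: "\<forall>T I. 0 \<le> c T I" "p = (\<Sum>T\<in>{T. T \<subseteq> V \<and> card T \<le> t}. \<Sum>I\<in>Pow T. Const (c T I) * handelman_monomial T I)" and
    d: "\<forall>T I. 0 \<le> d T I" "q = (\<Sum>T\<in>{T. T \<subseteq> V \<and> card T \<le> t}. \<Sum>I\<in>Pow T. Const (d T I) * handelman_monomial T I)"
    unfolding handelman_set_altdef by blast
  have "p + q = (\<Sum>T\<in>{T. T \<subseteq> V \<and> card T \<le> t}. \<Sum>I\<in>Pow T. Const (c T I + d T I) * handelman_monomial T I)"
    unfolding c d by (simp add: Const_add distrib_right sum.distrib)
  moreover have "\<forall>T I. 0 \<le> c T I + d T I" using c d by simp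
  ultimately show ?thesis unfolding handelman_set_altdef
    by (intro CollectI exI[of _ "\<lambda>T I. c T I + d T I"]) simp
qed

text \<open>Replaces the handling of coefficient families: the properties below are checked on one
  scaled generator at a time.\<close>

lemma handelman_set_induct [consumes 1, case_names zero add monomial]:
  assumes "p \<in> handelman_set V t"
    and "P 0" "\<And>p q. P p \<Longrightarrow> P q \<Longrightarrow> P (p + q)"
    and "\<And>c T I. 0 \<le> c \<Longrightarrow> T \<subseteq> V \<Longrightarrow> card T \<le> t \<Longrightarrow> I \<subseteq> T \<Longrightarrow> P (Const c * handelman_monomial T I)"
  shows "P p"
proof -
  have sum: "P (sum f A)" if "\<And>a. a \<in> A \<Longrightarrow> P (f a)" for f and A :: "'b set"
    using that by (induction A rule: infinite_finite_induct) (auto intro: assms)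
  from assms(1) obtain c where
    c: "\<forall>T I. 0 \<le> c T I" "p = (\<Sum>T\<in>{T. T \<subseteq> V \<and> card T \<le> t}. \<Sum>I\<in>Pow T. Const (c T I) * handelman_monomial T I)"
    unfolding handelman_set_altdef by blast
  show ?thesis unfolding c(2) by (intro sum) (use c(1) assms(4) in auto)
qed

lemma handelman_set_0 [simp]: "0 \<in> handelman_set V t"
  unfolding handelman_set_altdef by (intro CollectI exI[of _ "\<lambda>_ _. 0"]) simp

lemma handelman_set_sum:
  assumes "\<And>a. a \<in> A \<Longrightarrow> f a \<in> handelman_set V t"
  shows "sum f A \<in> handelman_set V t"
  using assms by (induction A rule: infinite_finite_induct) (auto intro: handelman_set_add)

lemma handelman_set_scale:
  assumes "finite V" "p \<in> handelman_set V t" "0 \<le> c"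
  shows "Const c * p \<in> handelman_set V t"
  using assms(2)
proof (induction p rule: handelman_set_induct)
  case (add p q)
  then show ?case by (simp add: distrib_left handelman_set_add)
next
  case (monomial d T I)
  have "Const (c * d) * handelman_monomial T I \<in> handelman_set V t"
    using assms monomial by (intro handelman_set_monomial) auto
  then show ?case by (simp add: Const_mult mult.assoc)
qed simp

lemma handelman_set_mono:
  assumes "finite V" "p \<in> handelman_set W s" "W \<subseteq> V" "s \<le> t"
  shows "p \<in> handelman_set V t"
  using assms(2)
proof (induction p rule: handelman_set_induct)
  case (monomial c T I)
  then show ?case using assms by (intro handelman_set_monomial) auto
qed (auto intro: handelman_set_add)

text \<open>Generators over \<open>V - {i}\<close> do not involve \<open>i\<close>, so the product
  stays square-free and is again a generator, with \<open>T\<close> larger by one node. This is the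
  one level that branching costs.\<close>

lemma handelman_set_Var_mult:
  assumes "finite V" "i \<in> V" "p \<in> handelman_set (V - {i}) t"
  shows "Var i * p \<in> handelman_set V (Suc t)"
  using assms(3)
proof (induction p rule: handelman_set_induct)
  case (add p q)
  then show ?case by (simp add: distrib_left handelman_set_add)
next
  case (monomial c T I)
  have fin: "finite T" "finite I" and i: "i \<notin> T" "i \<notin> I"
    using monomial assms finite_subset by (blast intro: finite_subset)+
  then have "Var i * (Const c * handelman_monomial T I)
      = Const c * handelman_monomial (insert i T) (insert i I)"
    by (simp add: handelman_monomial_def mult_ac)
  also have "\<dots> \<in> handelman_set V (Suc t)"
    using monomial assms i fin by (intro handelman_set_monomial) auto
  finally show ?case .
qed simp

lemma handelman_set_one_minus_Var_mult:
  assumes "finite V" "i \<in> V" "p \<in> handelman_set (V - {i}) t"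
  shows "(1 - Var i) * p \<in> handelman_set V (Suc t)"
  using assms(3)
proof (induction p rule: handelman_set_induct)
  case (add p q)
  then show ?case by (simp add: distrib_left handelman_set_add)
next
  case (monomial c T I)
  have fin: "finite T" "finite I" and i: "i \<notin> T" "i \<notin> I"
    using monomial assms finite_subset by (blast intro: finite_subset)+
  have "insert i T - I = insert i (T - I)" using i by auto
  then have "(1 - Var i) * (Const c * handelman_monomial T I)
      = Const c * handelman_monomial (insert i T) I"
    using fin i by (simp add: handelman_monomial_def mult_ac)
  also have "\<dots> \<in> handelman_set V (Suc t)"
    using monomial assms i fin by (intro handelman_set_monomial) auto
  finally show ?case .
qed simp

lemma handelman_set_prod_Var:
  assumes "finite V" "I \<subseteq> V" "card I \<le> t" "0 \<le> c"
  shows "Const c * (\<Prod>i\<in>I. Var i) \<in> handelman_set V t"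
  using handelman_set_monomial[OF assms(1-3), of I c] assms by (simp add: handelman_monomial_def)

lemma handelman_set_prod_one_minus_Var:
  assumes "finite V" "I \<subseteq> V" "card I \<le> t" "0 \<le> c"
  shows "Const c * (\<Prod>i\<in>I. 1 - Var i) \<in> handelman_set V t"
  using handelman_set_monomial[OF assms(1-3), of "{}" c] assms by (simp add: handelman_monomial_def)

section \<open>Evaluation at 0/1 points\<close>

text \<open>The value of \<open>p\<close> at the 0/1 point with support \<open>S\<close>: there a
  monomial is 1 if all its variables lie in \<open>S\<close>, and 0 otherwise.\<close>

definition eval_indicator :: "'a set \<Rightarrow> 'a rpoly \<Rightarrow> real" where
  "eval_indicator S p = (\<Sum>m\<in>{m\<in>Poly_Mapping.keys p. Poly_Mapping.keys m \<subseteq> S}. Poly_Mapping.lookup p m)"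

lemma eval_indicator_superset:
  assumes "finite A" "Poly_Mapping.keys p \<subseteq> A"
  shows "eval_indicator S p = (\<Sum>m\<in>{m\<in>A. Poly_Mapping.keys m \<subseteq> S}. Poly_Mapping.lookup p m)"
  unfolding eval_indicator_def
  by (rule sum.mono_neutral_left) (use assms in \<open>auto simp: in_keys_iff\<close>)

lemma eval_indicator_add: "eval_indicator S (p + q) = eval_indicator S p + eval_indicator S q"
proof -
  let ?A = "Poly_Mapping.keys p \<union> Poly_Mapping.keys q"
  have "Poly_Mapping.keys (p + q) \<subseteq> ?A" by (rule keys_add)
  then show ?thesis
    by (simp add: eval_indicator_superset[of ?A] lookup_add sum.distrib)
qed

lemma eval_indicator_uminus: "eval_indicator S (- p) = - eval_indicator S p"
  by (simp add: eval_indicator_def sum_negf)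

lemma eval_indicator_diff: "eval_indicator S (p - q) = eval_indicator S p - eval_indicator S q"
  using eval_indicator_add[of S p "- q"] by (simp add: eval_indicator_uminus)

lemma eval_indicator_0 [simp]: "eval_indicator S 0 = 0"
  by (simp add: eval_indicator_def)

lemma eval_indicator_sum: "eval_indicator S (sum f A) = (\<Sum>a\<in>A. eval_indicator S (f a))"
  by (induction A rule: infinite_finite_induct) (simp_all add: eval_indicator_add)

lemma eval_indicator_single:
  "eval_indicator S (Poly_Mapping.single m c) = (if Poly_Mapping.keys m \<subseteq> S then c else 0)"
proof -
  have "{m'\<in>{m}. Poly_Mapping.keys m' \<subseteq> S} = (if Poly_Mapping.keys m \<subseteq> S then {m} else {})" by auto
  then show ?thesis by (subst eval_indicator_superset[of "{m}"]) auto
qed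

lemma keys_add_nat:
  fixes m n :: "'a \<Rightarrow>\<^sub>0 nat"
  shows "Poly_Mapping.keys (m + n) = Poly_Mapping.keys m \<union> Poly_Mapping.keys n"
  by (auto simp: in_keys_iff lookup_add)

lemma rpoly_eq_sum_single: 
  "(\<Sum>m\<in>Poly_Mapping.keys p. Poly_Mapping.single m (Poly_Mapping.lookup p m)) = (p :: 'a rpoly)"
  by (rule poly_mapping_eqI) (simp add: lookup_sum lookup_single when_def in_keys_iff)

text \<open>By bilinearity two monomials suffice. Natural exponents cannot cancel, so a product of
  monomials is supported in \<open>S\<close> exactly if both factors are.\<close>

lemma eval_indicator_mult: "eval_indicator S (p * q) = eval_indicator S p * eval_indicator S q"
proof -
  have "eval_indicator S ((\<Sum>m\<in>Poly_Mapping.keys p. Poly_Mapping.single m (Poly_Mapping.lookup p m)) *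
          (\<Sum>n\<in>Poly_Mapping.keys q. Poly_Mapping.single n (Poly_Mapping.lookup q n)))
      = eval_indicator S (\<Sum>m\<in>Poly_Mapping.keys p. Poly_Mapping.single m (Poly_Mapping.lookup p m)) *
        eval_indicator S (\<Sum>n\<in>Poly_Mapping.keys q. Poly_Mapping.single n (Poly_Mapping.lookup q n))"
    unfolding sum_product eval_indicator_sum
    by (intro sum.cong refl) (auto simp: mult_single eval_indicator_single keys_add_nat)
  then show ?thesis by (simp only: rpoly_eq_sum_single)
qed

lemma eval_indicator_Const [simp]: "eval_indicator S (Const c) = c"
  by (simp add: Const_def eval_indicator_single)

lemma eval_indicator_1 [simp]: "eval_indicator S 1 = 1"
  using eval_indicator_Const[of S 1] by simp

lemma eval_indicator_Var [simp]: "eval_indicator S (Var i) = of_bool (i \<in> S)"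
  by (simp add: Var_def eval_indicator_single)

lemma eval_indicator_prod: "eval_indicator S (prod f A) = (\<Prod>a\<in>A. eval_indicator S (f a))"
  by (induction A rule: infinite_finite_induct) (simp_all add: eval_indicator_mult)

text \<open>At a 0/1 point every generator is a product of zeros and ones. This makes certificates
  sound.\<close>

lemma eval_indicator_handelman_set_nonneg:
  assumes "p \<in> handelman_set V t"
  shows "0 \<le> eval_indicator S p"
  using assms
  by (induction p rule: handelman_set_induct)
     (auto simp: eval_indicator_add eval_indicator_mult handelman_monomial_def
        eval_indicator_prod eval_indicator_diff intro!: mult_nonneg_nonneg prod_nonneg)

section \<open>Weighted graphs and polynomials of induced subgraphs\<close>

text \<open>No node set is fixed, because the induction runs over node subsets. One inequality
  encodes the maximum over both ends, since \<open>{i, j} = {j, i}\<close>.\<close>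

locale weighted_graph =
  fixes E :: "'a set set" and w :: "'a \<Rightarrow> nat" and u :: "'a set \<Rightarrow> real"
  assumes card_edge: "e \<in> E \<Longrightarrow> card e = 2"
    and edge_weight_ge: "{i, j} \<in> E \<Longrightarrow> real (w i) \<le> u {i, j}"
begin

abbreviation adj :: "'a \<Rightarrow> 'a \<Rightarrow> bool" where "adj i j \<equiv> {i, j} \<in> E"

definition induced :: "'a set \<Rightarrow> 'a set set" where "induced W = {e \<in> E. e \<subseteq> W}"

definition edge_term :: "'a set \<Rightarrow> 'a rpoly" where
  "edge_term e = Const (u e) * (\<Prod>i\<in>e. Var i)"

definition induced_poly :: "'a set \<Rightarrow> 'a rpoly" where
  "induced_poly W = graph_poly W (induced W) w u"

lemma induced_poly_eq:
  "induced_poly W = (\<Sum>i\<in>W. Const (real (w i)) * Var i) - (\<Sum>e\<in>induced W. edge_term e)"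
  by (simp add: induced_poly_def graph_poly_def edge_term_def)

lemma adj_sym: "adj i j \<Longrightarrow> adj j i" by (simp add: insert_commute)

lemma not_adj_self: "\<not> adj i i" using card_edge[of "{i}"] by auto

lemma edge_cases:
  assumes "e \<in> E" obtains i j where "e = {i, j}" "i \<noteq> j"
  using card_edge[OF assms] by (auto simp: card_2_iff)

lemma edge_at_cases:
  assumes "e \<in> E" "i \<in> e" obtains j where "e = {i, j}"
proof -
  from assms(1) obtain a b where ab: "e = {a, b}" by (rule edge_cases)
  with assms(2) consider "i = a" | "i = b" by auto
  then show thesis
  proof cases
    case 1
    with ab show thesis by (intro that[of b]) simp
  next
    case 2
    with ab show thesis by (intro that[of a]) (simp add: insert_commute)
  qed
qed

lemma edge_weight_nonneg: "e \<in> E \<Longrightarrow> 0 \<le> u e"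
  using edge_weight_ge by (metis edge_cases of_nat_0_le_iff order_trans)

lemma finite_induced [simp]: "finite W \<Longrightarrow> finite (induced W)"
  by (rule finite_subset[of _ "Pow W"]) (auto simp: induced_def)

lemma induced_empty: "induced {} = {}"
  using card_edge by (fastforce simp: induced_def)

lemma edge_term_in_handelman_set:
  assumes "finite W" "e \<in> E" "e \<subseteq> W" "2 \<le> t"
  shows "edge_term e \<in> handelman_set W t"
  unfolding edge_term_def
  using assms card_edge edge_weight_nonneg by (intro handelman_set_prod_Var) auto

definition crossing :: "'a set \<Rightarrow> 'a set \<Rightarrow> 'a set set" where
  "crossing A B = {e \<in> E. e \<subseteq> A \<union> B \<and> \<not> e \<subseteq> A \<and> \<not> e \<subseteq> B}"

text \<open>Crossing edges enter the negated polynomial with nonnegative coefficients, so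
  certificates for two disjoint parts add up to one for their union.\<close>

lemma induced_poly_Un:
  assumes "finite A" "finite B" "A \<inter> B = {}"
  shows "induced_poly (A \<union> B) = induced_poly A + induced_poly B - (\<Sum>e\<in>crossing A B. edge_term e)"
proof -
  have fin: "finite (crossing A B)"
    by (rule finite_subset[of _ "Pow (A \<union> B)"]) (use assms in \<open>auto simp: crossing_def\<close>)
  have "{} \<notin> E" using card_edge by fastforce
  then have dj: "induced A \<inter> induced B = {}"
    using assms unfolding induced_def by (auto dest: Int_greatest)
  have dj2: "(induced A \<union> induced B) \<inter> crossing A B = {}"
    by (auto simp: induced_def crossing_def)
  have "induced (A \<union> B) = (induced A \<union> induced B) \<union> crossing A B"
    by (auto simp: induced_def crossing_def)
  then have "(\<Sum>e\<in>induced (A \<union> B). edge_term e)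
     = (\<Sum>e\<in>induced A. edge_term e) + (\<Sum>e\<in>induced B. edge_term e) + (\<Sum>e\<in>crossing A B. edge_term e)"
    using fin assms dj dj2 by (simp add: sum.union_disjoint)
  then show ?thesis using assms by (simp add: induced_poly_eq sum.union_disjoint)
qed

section \<open>Level-two certificates from edge covers\<close>

text \<open>Each edge of the graph has two copies \<open>(i, j)\<close> and \<open>(j, i)\<close> in
  the double cover; the sum over ordered pairs is grouped by the underlying edge.\<close>

lemma sum_konig_cover_edges:
  fixes f :: "'a \<Rightarrow> 'a \<Rightarrow> nat" and X :: "'a \<Rightarrow> 'a rpoly"
  assumes "finite W" "\<And>i j. f i j \<noteq> 0 \<Longrightarrow> adj i j"
  shows "(\<Sum>i\<in>W. \<Sum>j\<in>W. Const (real (f i j)) * (X i * X j))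
    = (\<Sum>e\<in>induced W. Const (real (\<Sum>(i, j)\<in>{(i, j) \<in> W \<times> W. {i, j} = e}. f i j)) * (\<Prod>i\<in>e. X i))"
proof -
  let ?P = "{(i, j) \<in> W \<times> W. adj i j}"
  let ?t = "\<lambda>(i, j). Const (real (f i j)) * (X i * X j)"
  have fin: "finite ?P" by (rule finite_subset[of _ "W \<times> W"]) (use assms in auto)
  have "(\<Sum>i\<in>W. \<Sum>j\<in>W. Const (real (f i j)) * (X i * X j)) = (\<Sum>p\<in>W \<times> W. ?t p)"
    by (simp add: sum.cartesian_product)
  also have "\<dots> = (\<Sum>p\<in>?P. ?t p)"
  proof (rule sum.mono_neutral_right)
    show "\<forall>p\<in>W \<times> W - ?P. ?t p = 0"
    proof
      fix p assume "p \<in> W \<times> W - ?P"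
      then have "f (fst p) (snd p) = 0" using assms(2)[of "fst p" "snd p"] by auto
      then show "?t p = 0" by (simp add: case_prod_beta)
    qed
  qed (use assms in auto)
  also have "\<dots> = (\<Sum>e\<in>induced W. \<Sum>p\<in>{p \<in> ?P. (\<lambda>(i, j). {i, j}) p = e}. ?t p)"
    by (rule sum.group[symmetric]) (use fin assms in \<open>auto simp: induced_def\<close>)
  also have "\<dots> = (\<Sum>e\<in>induced W. \<Sum>p\<in>{(i, j) \<in> W \<times> W. {i, j} = e}.
                    Const (real (case p of (i, j) \<Rightarrow> f i j)) * (\<Prod>i\<in>e. X i))"
  proof (intro sum.cong refl)
    fix e assume e: "e \<in> induced W"
    then show "{p \<in> ?P. (\<lambda>(i, j). {i, j}) p = e} = {(i, j) \<in> W \<times> W. {i, j} = e}"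
      by (auto simp: induced_def)
    fix p assume "p \<in> {(i, j) \<in> W \<times> W. {i, j} = e}"
    then obtain i j where p: "p = (i, j)" "e = {i, j}" by auto
    with e not_adj_self have "i \<noteq> j" by (auto simp: induced_def)
    then show "?t p = Const (real (case p of (i, j) \<Rightarrow> f i j)) * (\<Prod>i\<in>e. X i)"
      by (simp add: p)
  qed
  finally show ?thesis
    by (simp add: Const_sum sum_distrib_right)
qed

text \<open>Exactness of the cover gives \<open>f i j \<le> w i\<close> and
  \<open>f j i \<le> w j\<close>, and the edge weight dominates both node weights.\<close>

lemma konig_cover_edge_le:
  assumes "finite W" "konig_cover W W adj w w f g h" "e \<in> induced W"
  shows "real (\<Sum>(i, j)\<in>{(i, j) \<in> W \<times> W. {i, j} = e}. f i j) \<le> 2 * u e"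
proof -
  from assms(3) have "e \<in> E" "e \<subseteq> W" by (auto simp: induced_def)
  from this(1) obtain i j where ij: "e = {i, j}" "i \<noteq> j" by (rule edge_cases)
  with \<open>e \<in> E\<close> \<open>e \<subseteq> W\<close> have e: "e = {i, j}" "i \<noteq> j" "e \<in> E" "i \<in> W" "j \<in> W" by auto
  have le: "f a b \<le> w a" if "a \<in> W" "b \<in> W" for a b
  proof -
    have "f a b \<le> (\<Sum>y\<in>W. f a y)" using that assms(1) by (intro member_le_sum) auto
    then show ?thesis using assms(2) that by (auto simp: konig_cover_def)
  qed
  have "{(i, j) \<in> W \<times> W. {i, j} = e} = {(i, j), (j, i)}"
    using e by (auto simp: doubleton_eq_iff)
  then have "real (\<Sum>(i, j)\<in>{(i, j) \<in> W \<times> W. {i, j} = e}. f i j) = real (f i j) + real (f j i)"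
    using e by simp
  moreover have "real (f i j) \<le> u e" "real (f j i) \<le> u e"
    using le[of i j] le[of j i] e edge_weight_ge[of i j] edge_weight_ge[of j i]
    by (auto simp: insert_commute)
  ultimately show ?thesis by simp
qed

text \<open>Twice \<open>l - p\<close> is the slack of the total plus \<open>P1 + P2 + P3\<close>.
  Linear terms match because the cover is exact on both sides of the double cover, each contributing
  \<open>w i\<close> once; in the quadratic terms the \<open>Q\<close> produced by \<open>P1\<close>
  is cancelled by \<open>P3\<close>, which stays nonnegative by
  \<open>konig_cover_edge_le\<close>.\<close>

lemma konig_cover_handelman:
  assumes W: "finite W" and cover: "konig_cover W W adj w w f g h"
    and total: "(\<Sum>i\<in>W. \<Sum>j\<in>W. f i j) + sum g W + sum h W \<le> 2 * l"
  shows "Const (real l) - induced_poly W \<in> handelman_set W 2"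
proof -
  define c where "c e = real (\<Sum>(i, j)\<in>{(i, j) \<in> W \<times> W. {i, j} = e}. f i j)" for e
  define F where "F = (\<Sum>i\<in>W. \<Sum>j\<in>W. f i j)"
  define S1 where "S1 = (\<Sum>i\<in>W. Const (real (\<Sum>j\<in>W. f i j)) * Var i)"
  define S2 where "S2 = (\<Sum>j\<in>W. Const (real (\<Sum>i\<in>W. f i j)) * Var j)"
  define G where "G = (\<Sum>i\<in>W. Const (real (g i)) * Var i)"
  define H where "H = (\<Sum>i\<in>W. Const (real (h i)) * Var i)"
  define Q where "Q = (\<Sum>e\<in>induced W. Const (c e) * (\<Prod>i\<in>e. Var i))"
  define P1 where "P1 = (\<Sum>i\<in>W. \<Sum>j\<in>W. Const (real (f i j)) * ((1 - Var i) * (1 - Var j)))"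
  define P2 where "P2 = (\<Sum>i\<in>W. Const (real (g i + h i)) * (\<Prod>j\<in>{i}. 1 - Var j))"
  define P3 where "P3 = (\<Sum>e\<in>induced W. Const (2 * u e - c e) * (\<Prod>i\<in>e. Var i))"
  define slack where "slack = real (2 * l) - real (F + sum g W + sum h W)"
  have adj: "adj i j" if "f i j \<noteq> 0" for i j using cover that by (auto simp: konig_cover_def)
  have F: "(\<Sum>i\<in>W. \<Sum>j\<in>W. Const (real (f i j))) = Const (real F)"
    by (simp add: F_def Const_sum)
  have S1: "(\<Sum>i\<in>W. \<Sum>j\<in>W. Const (real (f i j)) * Var i) = S1"
    by (simp add: S1_def Const_sum sum_distrib_right)
  have S2: "(\<Sum>i\<in>W. \<Sum>j\<in>W. Const (real (f i j)) * Var j) = S2"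
    unfolding S2_def by (subst sum.swap) (simp add: Const_sum sum_distrib_right)
  have Q: "(\<Sum>i\<in>W. \<Sum>j\<in>W. Const (real (f i j)) * (Var i * Var j)) = Q"
    using sum_konig_cover_edges[OF W adj, of f Var] by (simp add: Q_def c_def)
  have "P1 = (\<Sum>i\<in>W. \<Sum>j\<in>W. Const (real (f i j)) - Const (real (f i j)) * Var i
      - Const (real (f i j)) * Var j + Const (real (f i j)) * (Var i * Var j))"
    unfolding P1_def by (intro sum.cong refl) (simp add: algebra_simps)
  also have "\<dots> = Const (real F) - S1 - S2 + Q"
    by (simp only: sum.distrib sum_subtractf F S1 S2 Q)
  finally have P1: "P1 = Const (real F) - S1 - S2 + Q" .
  have P2: "P2 = Const (real (sum g W)) + Const (real (sum h W)) - G - H"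
    by (simp add: P2_def G_def H_def Const_add Const_sum algebra_simps sum.distrib sum_subtractf)
  have P3: "P3 = 2 * (\<Sum>e\<in>induced W. edge_term e) - Q"
  proof -
    have "Const (2 * u e - c e) * (\<Prod>i\<in>e. Var i) = 2 * edge_term e - Const (c e) * (\<Prod>i\<in>e. Var i)" for e
    proof -
      have "(Const (2 * u e) :: 'a rpoly) = 2 * Const (u e)" using Const_add[of "u e" "u e"] by simp
      then show ?thesis by (simp only: edge_term_def Const_diff left_diff_distrib mult.assoc)
    qed
    then show ?thesis by (simp add: P3_def Q_def sum_subtractf sum_distrib_left)
  qed
  have wg: "w i = g i + (\<Sum>j\<in>W. f i j)" and wh: "w i = h i + (\<Sum>j\<in>W. f j i)" if "i \<in> W" for i
    using cover that by (auto simp: konig_cover_def)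
  have w1: "(\<Sum>i\<in>W. Const (real (w i)) * Var i) = G + S1"
    unfolding G_def S1_def sum.distrib[symmetric]
    by (intro sum.cong refl) (simp only: wg of_nat_add Const_add distrib_right)
  have w2: "(\<Sum>i\<in>W. Const (real (w i)) * Var i) = H + S2"
    unfolding H_def S2_def sum.distrib[symmetric]
    by (intro sum.cong refl) (simp only: wh of_nat_add Const_add distrib_right)
  have slack: "(Const slack :: 'a rpoly) = 2 * Const (real l) - Const (real F) - Const (real (sum g W)) - Const (real (sum h W))"
  proof -
    have "slack = real l + real l - real F - real (sum g W) - real (sum h W)"
      by (simp add: slack_def del: of_nat_sum)
    then show ?thesis by (simp only: Const_diff Const_add mult_2)
  qed
  have "2 * (Const (real l) - induced_poly W) = Const slack + P1 + P2 + P3"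
    using w1 w2 unfolding induced_poly_eq P1 P2 P3 slack by (simp add: algebra_simps)
  moreover have "Const (1/2) * (2 * p) = p" for p :: "'a rpoly"
  proof -
    have "Const (1/2) * (2 * p) = (Const (1/2) + Const (1/2)) * p" by (simp add: algebra_simps)
    then show ?thesis by (simp flip: Const_add)
  qed
  ultimately have eq: "Const (real l) - induced_poly W = Const (1/2) * (Const slack + P1 + P2 + P3)"
    by metis
  have "0 \<le> slack" using total by (simp add: slack_def F_def flip: of_nat_add of_nat_sum)
  then have "Const slack \<in> handelman_set W 2"
    using handelman_set_prod_Var[of W "{}" 2 slack] W by simp
  moreover have "P1 \<in> handelman_set W 2"
    unfolding P1_def
  proof (intro handelman_set_sum)
    fix i j assume "i \<in> W" "j \<in> W"
    show "Const (real (f i j)) * ((1 - Var i) * (1 - Var j)) \<in> handelman_set W 2"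
    proof (cases "f i j = 0")
      case False
      \<comment> \<open>Generators are square-free, so \<open>(1 - Var i) * (1 - Var j)\<close> is
        one only for distinct nodes.\<close>
      then have "i \<noteq> j" using adj[of i j] not_adj_self by auto
      then show ?thesis
        using handelman_set_prod_one_minus_Var[of W "{i, j}" 2 "real (f i j)"] W \<open>i \<in> W\<close> \<open>j \<in> W\<close>
        by simp
    qed simp
  qed
  moreover have "P2 \<in> handelman_set W 2"
    unfolding P2_def using W by (intro handelman_set_sum handelman_set_prod_one_minus_Var) auto
  moreover have "P3 \<in> handelman_set W 2"
    unfolding P3_def
  proof (intro handelman_set_sum handelman_set_prod_Var)
    fix e assume e: "e \<in> induced W"
    then show "e \<subseteq> W" "card e \<le> 2" using card_edge by (auto simp: induced_def)
    show "0 \<le> 2 * u e - c e" using konig_cover_edge_le[OF W cover e] by (simp add: c_def)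
  qed (use W in auto)
  ultimately show ?thesis
    unfolding eq by (intro handelman_set_scale handelman_set_add W) auto
qed

section \<open>Branching on a node\<close>

text \<open>Fixing \<open>Var i = 1\<close> effectively deletes the neighbours of \<open>i\<close>
  as well: each edge at \<open>i\<close> leaves \<open>u {i, j} * Var j\<close>, which outweighs the
  gain \<open>w j * Var j\<close>. Hence a certificate on the non-neighbours suffices for that
  branch.\<close>

lemma branch_handelman:
  assumes W: "finite W" "i \<in> W" and t: "2 \<le> t" and N: "N = {j \<in> W. adj i j}"
    and del: "Const l - induced_poly (W - {i}) \<in> handelman_set (W - {i}) t"
    and contr: "Const (l - real (w i)) - induced_poly (W - {i} - N) \<in> handelman_set (W - {i} - N) t"
  shows "Const l - induced_poly W \<in> handelman_set W (Suc t)"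
proof -
  define M where "M = W - {i} - N"
  \<comment> \<open>\<open>D\<close> is what the edges at \<open>i\<close> become at
    \<open>Var i = 1\<close>, and \<open>R\<close> is the restriction of
    \<open>Const l - induced_poly W\<close> to that value.\<close>
  define D where "D = (\<Sum>j\<in>N. Const (u {i, j}) * Var j)"
  define R where "R = Const (l - real (w i)) - induced_poly (W - {i}) + D"
  have iN: "i \<notin> N" using N not_adj_self by auto
  have fin: "finite N" "finite M" using W N by (auto simp: M_def)
  have "induced {i} = {}"
    using not_adj_self by (auto simp: induced_def subset_singleton_iff) (use card_edge in fastforce)
  then have "induced_poly {i} = Const (real (w i)) * Var i" by (simp add: induced_poly_eq)
  moreover have "(\<Sum>e\<in>crossing {i} (W - {i}). edge_term e) = Var i * D"
  proof -
    have "crossing {i} (W - {i}) = (\<lambda>j. {i, j}) ` N"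
    proof (intro equalityI subsetI)
      fix e assume e: "e \<in> crossing {i} (W - {i})"
      then have "e \<in> E" "i \<in> e" by (auto simp: crossing_def)
      then obtain j where j: "e = {i, j}" by (rule edge_at_cases)
      then have "j \<in> W" "adj i j" using e W(2) by (auto simp: crossing_def)
      then have "j \<in> N" by (simp add: N)
      then show "e \<in> (\<lambda>j. {i, j}) ` N" unfolding j by (rule imageI)
    next
      fix e assume "e \<in> (\<lambda>j. {i, j}) ` N"
      then obtain j where "e = {i, j}" "adj i j" "j \<in> W" by (auto simp: N)
      moreover from this have "j \<noteq> i" using not_adj_self by blast
      ultimately show "e \<in> crossing {i} (W - {i})" using W(2) by (simp add: crossing_def)
    qed
    moreover have "inj_on (\<lambda>j. {i, j}) N"
      by (rule inj_onI) (metis doubleton_eq_iff)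
    ultimately have "(\<Sum>e\<in>crossing {i} (W - {i}). edge_term e) = (\<Sum>j\<in>N. edge_term {i, j})"
      by (simp add: sum.reindex)
    also have "\<dots> = (\<Sum>j\<in>N. Var i * (Const (u {i, j}) * Var j))"
    proof (intro sum.cong refl)
      fix j assume "j \<in> N"
      then have "i \<noteq> j" using iN by auto
      then show "edge_term {i, j} = Var i * (Const (u {i, j}) * Var j)"
        by (simp add: edge_term_def mult_ac)
    qed
    finally show ?thesis by (simp add: D_def sum_distrib_left)
  qed
  moreover have "induced_poly ({i} \<union> (W - {i})) = induced_poly {i} + induced_poly (W - {i})
      - (\<Sum>e\<in>crossing {i} (W - {i}). edge_term e)"
    using W by (intro induced_poly_Un) auto
  moreover have "{i} \<union> (W - {i}) = W" using W by auto
  ultimately have qW: "induced_poly W = Const (real (w i)) * Var i + induced_poly (W - {i}) - Var i * D"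
    by simp
  \<comment> \<open>Linear interpolation in \<open>Var i\<close> between its values 1 and 0.\<close>
  have split: "Const l - induced_poly W
      = Var i * R + (1 - Var i) * (Const l - induced_poly (W - {i}))"
    unfolding qW R_def by (simp add: Const_diff algebra_simps)
  have "N \<union> M = W - {i}" "N \<inter> M = {}" using iN N by (auto simp: M_def)
  then have "induced_poly (W - {i}) = induced_poly N + induced_poly M - (\<Sum>e\<in>crossing N M. edge_term e)"
    using induced_poly_Un[of N M] fin by simp
  moreover have "D = (\<Sum>j\<in>N. Const (u {i, j} - real (w j)) * (\<Prod>k\<in>{j}. Var k))
      + (\<Sum>j\<in>N. Const (real (w j)) * Var j)"
    by (simp add: D_def Const_diff algebra_simps flip: sum.distrib)
  ultimately have R: "R = (Const (l - real (w i)) - induced_poly M)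
      + (\<Sum>j\<in>N. Const (u {i, j} - real (w j)) * (\<Prod>k\<in>{j}. Var k))
      + (\<Sum>e\<in>induced N. edge_term e) + (\<Sum>e\<in>crossing N M. edge_term e)"
    by (simp add: R_def induced_poly_eq[of N])
  have "R \<in> handelman_set (W - {i}) t"
    unfolding R
  proof (intro handelman_set_add handelman_set_sum)
    show "Const (l - real (w i)) - induced_poly M \<in> handelman_set (W - {i}) t"
      by (rule handelman_set_mono[OF _ contr[folded M_def]]) (use W in \<open>auto simp: M_def\<close>)
  next
    fix j assume "j \<in> N"
    then show "Const (u {i, j} - real (w j)) * (\<Prod>k\<in>{j}. Var k) \<in> handelman_set (W - {i}) t"
      using W t iN edge_weight_ge[of j i]
      by (intro handelman_set_prod_Var) (auto simp: N insert_commute)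
  next
    fix e assume "e \<in> induced N"
    then show "edge_term e \<in> handelman_set (W - {i}) t"
      using W t N iN by (intro edge_term_in_handelman_set) (auto simp: induced_def)
  next
    fix e assume "e \<in> crossing N M"
    then show "edge_term e \<in> handelman_set (W - {i}) t"
      using W t N iN by (intro edge_term_in_handelman_set) (auto simp: crossing_def M_def)
  qed
  then show ?thesis
    unfolding split using W del
    by (intro handelman_set_add handelman_set_Var_mult handelman_set_one_minus_Var_mult)
qed

section \<open>The induction over node subsets\<close>

definition stable :: "'a set \<Rightarrow> bool" where
  "stable S \<longleftrightarrow> (\<forall>i\<in>S. \<forall>j\<in>S. \<not> adj i j)"

text \<open>\<open>l\<close> and \<open>k\<close> are mere upper bounds, so they can be passed on to
  induced subgraphs. Truncated subtraction keeps the level at 2 or more, which is what the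
  half-integral case needs.\<close>

lemma cross_stable_bound_handelman:
  assumes "finite W"
    and "\<And>S. S \<subseteq> W \<Longrightarrow> stable S \<Longrightarrow> sum w S \<le> l"
    and "\<And>X Y. X \<subseteq> W \<Longrightarrow> Y \<subseteq> W \<Longrightarrow> cross_stable adj X Y \<Longrightarrow> sum w X + sum w Y \<le> k"
  shows "Const (real l) - induced_poly W \<in> handelman_set W (k - 2 * l + 2)"
  using assms
proof (induction "card W" arbitrary: W l k rule: less_induct)
  case less
  note W = less.prems(1) and stab = less.prems(2) and bound = less.prems(3)
  have fin: "finite X" if "X \<subseteq> W" for X using that W finite_subset by blast
  have csD: "\<not> adj x y" "\<not> adj y x" if "cross_stable adj X Y" "x \<in> X" "y \<in> Y" for X Y x y
    using that adj_sym by (auto simp: cross_stable_def)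
  let ?tight = "\<lambda>X Y. X \<subseteq> W \<and> Y \<subseteq> W \<and> cross_stable adj X Y \<and> sum w X + sum w Y = k"
  \<comment> \<open>Duality on the double cover of \<open>U\<close>, where both sides are copies of
    \<open>U\<close>.\<close>
  have half: "Const (real l') - induced_poly U \<in> handelman_set U 2"
    if U: "finite U" "\<And>X Y. X \<subseteq> U \<Longrightarrow> Y \<subseteq> U \<Longrightarrow> cross_stable adj X Y \<Longrightarrow> sum w X + sum w Y \<le> 2 * l'"
    for U l'
  proof -
    have "\<exists>f g h. konig_cover U U adj w w f g h \<and>
            (\<Sum>i\<in>U. \<Sum>j\<in>U. f i j) + sum g U + sum h U \<le> 2 * l'"
      by (rule weighted_konig) (fact U)+
    then obtain f g h where "konig_cover U U adj w w f g h"
      "(\<Sum>i\<in>U. \<Sum>j\<in>U. f i j) + sum g U + sum h U \<le> 2 * l'"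
      by (elim exE conjE)
    then show ?thesis by (rule konig_cover_handelman[OF U(1)])
  qed
  \<comment> \<open>For a nested pair inside \<open>W\<close>, the condition
    \<open>X - Y = W\<close> says that the pair is \<open>(W, {})\<close>.\<close>
  consider "k \<le> 2 * l" | "W = {}"
    | X Y where "?tight X Y" "Y \<subseteq> X" "X - Y \<noteq> W"
    | i where "2 * l < k" "i \<in> W" "\<And>X Y. ?tight X Y \<Longrightarrow> Y \<subseteq> X \<Longrightarrow> X - Y = W"
  proof (cases "k \<le> 2 * l \<or> W = {} \<or> (\<exists>X Y. ?tight X Y \<and> Y \<subseteq> X \<and> X - Y \<noteq> W)")
    case True
    then show thesis by (elim disjE exE conjE) (rule that(1-3); blast)+
  next
    case False
    then obtain i where "i \<in> W" by blast
    with False show thesis by (intro that(4)[of i]) (simp, simp, blast)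
  qed
  then show ?case
  proof cases
    case 1
    then have "Const (real l) - induced_poly W \<in> handelman_set W 2"
      using bound W by (intro half) (auto intro: order_trans)
    then show ?thesis using 1 by (intro handelman_set_mono[OF W]) auto
  next
    case 2
    then show ?thesis
      using induced_empty handelman_set_prod_Var[of W "{}" "k - 2 * l + 2" "real l"]
      by (simp add: induced_poly_eq)
  next
    case (3 X Y)
    \<comment> \<open>The half-integral point of \<open>(X, Y)\<close> equals 1 on \<open>Y\<close>,
      1/2 on \<open>A\<close> and 0 on \<open>W - X\<close>; thus \<open>B\<close> is the part where
      it is integral.\<close>
    define A where "A = X - Y"
    define B where "B = W - A"
    define l' where "l' = l - sum w Y"
    have sub: "A \<subseteq> W" "B \<subseteq> W" "A \<noteq> W" and AB: "A \<union> B = W" "A \<inter> B = {}"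
      and YA: "Y \<inter> A = {}"
      using 3 by (auto simp: A_def B_def)
    have YY: "\<not> adj x y" "\<not> adj y x" if "x \<in> X" "y \<in> Y" for x y using csD 3 that by blast+
    \<comment> \<open>No edge joins \<open>Y\<close> to \<open>X\<close>, which contains both
      \<open>Y\<close> and \<open>A\<close>, so \<open>Y\<close> can be added to any stable subset
      of \<open>A\<close>.\<close>
    have stableY: "sum w S + sum w Y \<le> l" if "S \<subseteq> A" "stable S" for S
    proof -
      have "stable (S \<union> Y)" using that YY 3(2) unfolding stable_def A_def by blast
      then have "sum w (S \<union> Y) \<le> l" using that sub 3 by (intro stab) auto
      moreover have "sum w (S \<union> Y) = sum w S + sum w Y"
        using that YA sub 3 by (intro sum.union_disjoint fin) auto
      ultimately show ?thesis by simp
    qed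
    from stableY[of "{}"] have lY: "sum w Y \<le> l" by (simp add: stable_def)
    \<comment> \<open>Adding \<open>Y\<close> to both sides of a pair in \<open>A\<close> keeps it
      cross-stable. So \<open>k\<close> and \<open>2 * l\<close> both drop by
      \<open>2 * sum w Y\<close>, and the level does not grow.\<close>
    have "Const (real l') - induced_poly A \<in> handelman_set A (k - 2 * sum w Y - 2 * l' + 2)"
    proof (rule less.hyps)
      show "card A < card W" using sub W by (intro psubset_card_mono) auto
      show "finite A" using sub fin by auto
      show "sum w S \<le> l'" if "S \<subseteq> A" "stable S" for S using stableY[OF that] by (simp add: l'_def)
      show "sum w X' + sum w Y' \<le> k - 2 * sum w Y"
        if XY': "X' \<subseteq> A" "Y' \<subseteq> A" "cross_stable adj X' Y'" for X' Y'
      proof -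
        have "cross_stable adj (X' \<union> Y) (Y' \<union> Y)"
          using XY' YY 3(2) unfolding cross_stable_def A_def by blast
        then have "sum w (X' \<union> Y) + sum w (Y' \<union> Y) \<le> k"
          using XY' sub 3 by (intro bound) auto
        moreover have "sum w (X' \<union> Y) = sum w X' + sum w Y"
          using XY' YA sub 3 by (intro sum.union_disjoint fin) auto
        moreover have "sum w (Y' \<union> Y) = sum w Y' + sum w Y"
          using XY' YA sub 3 by (intro sum.union_disjoint fin) auto
        ultimately show ?thesis by simp
      qed
    qed
    moreover have "k - 2 * sum w Y - 2 * l' + 2 \<le> k - 2 * l + 2"
      using lY by (simp add: l'_def)
    ultimately have pA: "Const (real l') - induced_poly A \<in> handelman_set W (k - 2 * l + 2)"
      using W sub by (blast intro: handelman_set_mono)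
    have "Const (real (sum w Y)) - induced_poly B \<in> handelman_set B 2"
    proof (rule half)
      show "finite B" using sub fin by auto
      fix X' Y' assume XY': "X' \<subseteq> B" "Y' \<subseteq> B" "cross_stable adj X' Y'"
      \<comment> \<open>Exchange against the tight pair \<open>(X, Y)\<close>: enlarging
        \<open>X\<close> by \<open>Z\<close> while cutting \<open>Y\<close> down to
        \<open>Y \<inter> Z'\<close> cannot gain weight. Used for \<open>(X', Y')\<close> and its
        reversal, the two inequalities add up to the bound \<open>2 * sum w Y\<close>.\<close>
      have *: "sum w (Z - Y) + sum w (Y \<inter> Z') \<le> sum w Y"
        if Z: "Z \<subseteq> B" "Z' \<subseteq> B" "cross_stable adj Z Z'" for Z Z'
      proof -
        have "cross_stable adj (X \<union> Z) (Y \<inter> Z')"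
          using Z YY unfolding cross_stable_def by blast
        then have "sum w (X \<union> Z) + sum w (Y \<inter> Z') \<le> k"
          using Z sub 3 by (intro bound) auto
        moreover have XZ: "X \<union> Z = X \<union> (Z - Y)" "X \<inter> (Z - Y) = {}"
          using Z 3(2) by (auto simp: A_def B_def)
        moreover have "sum w (X \<union> Z) = sum w X + sum w (Z - Y)"
          unfolding XZ(1) by (intro sum.union_disjoint fin XZ(2)) (use Z(1) sub 3(1) in blast)+
        ultimately show ?thesis using 3 by linarith
      qed
      have "cross_stable adj Y' X'" using XY'(3) adj_sym unfolding cross_stable_def by blast
      with *[of X' Y'] *[of Y' X'] XY'
      have "sum w (X' - Y) + sum w (Y \<inter> Y') \<le> sum w Y" "sum w (Y' - Y) + sum w (Y \<inter> X') \<le> sum w Y"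
        by auto
      moreover have "sum w Z = sum w (Z - Y) + sum w (Y \<inter> Z)" if "Z \<subseteq> B" for Z
        using that sub fin[of Z] sum.Int_Diff[of Z w Y] by (auto simp: Int_commute)
      from this[OF XY'(1)] this[OF XY'(2)]
      have "sum w X' = sum w (X' - Y) + sum w (Y \<inter> X')" "sum w Y' = sum w (Y' - Y) + sum w (Y \<inter> Y')" .
      ultimately show "sum w X' + sum w Y' \<le> 2 * sum w Y" by linarith
    qed
    then have pB: "Const (real (sum w Y)) - induced_poly B \<in> handelman_set W (k - 2 * l + 2)"
      using W sub by (intro handelman_set_mono[of W _ B 2]) auto
    have pC: "(\<Sum>e\<in>crossing A B. edge_term e) \<in> handelman_set W (k - 2 * l + 2)"
      using W AB by (intro handelman_set_sum edge_term_in_handelman_set) (auto simp: crossing_def)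
    have "real l = real l' + real (sum w Y)" using lY by (simp add: l'_def)
    then have "Const (real l) = Const (real l') + Const (real (sum w Y))"
      by (simp only: Const_add)
    then have "Const (real l) - induced_poly W = (Const (real l') - induced_poly A)
        + (Const (real (sum w Y)) - induced_poly B) + (\<Sum>e\<in>crossing A B. edge_term e)"
      using induced_poly_Un[of A B] AB sub fin by simp
    then show ?thesis using pA pB pC by (simp add: handelman_set_add)
  next
    case (4 i)
    define N where "N = {j \<in> W. adj i j}"
    let ?M = "W - {i} - N"
    \<comment> \<open>Uncrossing a tight pair with its reversal gives the nested tight pair
      \<open>(X \<union> Y, Y \<inter> X)\<close>, whose difference must be all of \<open>W\<close>.
      So \<open>i\<close> lies on exactly one side of every tight pair.\<close>
    have strict: "sum w X + sum w Y < k"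
      if XY: "X \<subseteq> W" "Y \<subseteq> W" "cross_stable adj X Y" and i: "i \<notin> X \<union> Y \<or> i \<in> X \<inter> Y" for X Y
    proof (rule ccontr)
      assume "\<not> ?thesis"
      with bound[OF XY] have k: "sum w X + sum w Y = k" by simp
      have "cross_stable adj Y X" using XY(3) adj_sym unfolding cross_stable_def by blast
      with k XY cross_stable_uncross[OF W W bound, of adj X Y Y X]
      have "?tight (X \<union> Y) (Y \<inter> X)" by (auto simp: add.commute)
      from 4(3)[OF this] have "X \<union> Y - Y \<inter> X = W" by blast
      then show False using i 4(2) by blast
    qed
    have wi: "w i \<le> l" using stab[of "{i}"] 4(2) not_adj_self by (simp add: stable_def)
    have iN: "i \<notin> N" using not_adj_self by (simp add: N_def)
    have less: "card (W - {i}) < card W" "card ?M < card W"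
      by (rule psubset_card_mono; use W 4(2) in blast)+
    have fM: "finite (W - {i})" "finite ?M" using W by auto
    \<comment> \<open>Branch \<open>Var i = 0\<close>: pairs avoiding \<open>i\<close> are not
      tight, so \<open>k\<close> drops by one while \<open>l\<close> stays.\<close>
    have "Const (real l) - induced_poly (W - {i}) \<in> handelman_set (W - {i}) (k - 1 - 2 * l + 2)"
    proof (rule less.hyps[OF less(1) fM(1)])
      show "sum w S \<le> l" if "S \<subseteq> W - {i}" "stable S" for S
        using that by (intro stab) auto
      show "sum w X + sum w Y \<le> k - 1"
        if "X \<subseteq> W - {i}" "Y \<subseteq> W - {i}" "cross_stable adj X Y" for X Y
        using strict[of X Y] that by fastforce
    qed
    \<comment> \<open>Branch \<open>Var i = 1\<close>: \<open>i\<close> can be added to both sides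
      of a pair of non-neighbours, and the result is not tight. Thus \<open>k\<close> drops by
      \<open>2 * w i + 1\<close> and \<open>l\<close> by \<open>w i\<close>, giving the same level
      as the other branch.\<close>
    moreover have "Const (real (l - w i)) - induced_poly ?M
        \<in> handelman_set ?M (k - 1 - 2 * w i - 2 * (l - w i) + 2)"
    proof (rule less.hyps[OF less(2) fM(2)])
      show "sum w S \<le> l - w i" if S: "S \<subseteq> ?M" "stable S" for S
      proof -
        have "stable (insert i S)"
          using S not_adj_self adj_sym unfolding stable_def N_def by blast
        then have "sum w (insert i S) \<le> l" using S 4(2) by (intro stab) auto
        moreover have "sum w (insert i S) = w i + sum w S"
          using S fin[of S] by (intro sum.insert) auto
        ultimately show ?thesis by simp
      qed
      show "sum w X + sum w Y \<le> k - 1 - 2 * w i"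
        if XY: "X \<subseteq> ?M" "Y \<subseteq> ?M" "cross_stable adj X Y" for X Y
      proof -
        have "cross_stable adj (insert i X) (insert i Y)"
          using XY not_adj_self adj_sym unfolding cross_stable_def N_def by blast
        then have "sum w (insert i X) + sum w (insert i Y) < k"
          using XY 4(2) by (intro strict) auto
        moreover have "sum w (insert i X) = w i + sum w X" "sum w (insert i Y) = w i + sum w Y"
          using XY fin[of X] fin[of Y] by (auto intro!: sum.insert)
        ultimately show ?thesis by simp
      qed
    qed
    moreover have "k - 1 - 2 * w i - 2 * (l - w i) + 2 = k - 1 - 2 * l + 2" using wi by simp
    ultimately have "Const (real l) - induced_poly W \<in> handelman_set W (Suc (k - 1 - 2 * l + 2))"
      using wi 4(2) W N_def by (intro branch_handelman[of W i _ N]) (auto simp: of_nat_diff)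
    \<comment> \<open>Here \<open>2 * l < k\<close> excludes truncation, so the drop of
      \<open>k\<close> pays exactly for the extra level.\<close>
    moreover have "Suc (k - 1 - 2 * l + 2) = k - 2 * l + 2" using 4(1) by simp
    ultimately show ?thesis by (simp only:)
  qed
qed

section \<open>Stability number, lower bound and fractional relaxation\<close>

lemma stable_sets_iff: "S \<in> stable_sets V E \<longleftrightarrow> S \<subseteq> V \<and> stable S"
proof -
  have "(\<forall>e\<in>E. \<not> e \<subseteq> S) \<longleftrightarrow> stable S"
  proof
    assume *: "\<forall>e\<in>E. \<not> e \<subseteq> S"
    show "stable S"
      unfolding stable_def
    proof (intro ballI notI)
      fix i j assume "i \<in> S" "j \<in> S" "adj i j"
      with * have "\<not> {i, j} \<subseteq> S" by (elim bspec)
      with \<open>i \<in> S\<close> \<open>j \<in> S\<close> show False by simp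
    qed
  next
    assume S: "stable S"
    show "\<forall>e\<in>E. \<not> e \<subseteq> S"
    proof (intro ballI notI)
      fix e assume e: "e \<in> E" "e \<subseteq> S"
      from e(1) obtain i j where ij: "e = {i, j}" "i \<noteq> j" by (rule edge_cases)
      with e(2) have "i \<in> S" "j \<in> S" by simp_all
      with S have "\<not> adj i j" unfolding stable_def by simp
      with e(1) ij show False by simp
    qed
  qed
  then show ?thesis by (simp add: stable_sets_def)
qed

lemma
  assumes "finite V"
  shows stability_number_ge: "S \<subseteq> V \<Longrightarrow> stable S \<Longrightarrow> sum w S \<le> stability_number V E w"
    and stability_number_attained: "\<exists>S. S \<subseteq> V \<and> stable S \<and> sum w S = stability_number V E w"
proof -
  have fin: "finite (stable_sets V E)"
    by (rule finite_subset[of _ "Pow V"]) (use assms in \<open>auto simp: stable_sets_def\<close>)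
  then show "sum w S \<le> stability_number V E w" if "S \<subseteq> V" "stable S"
    unfolding stability_number_def by (intro Max_ge) (use that in \<open>auto simp: stable_sets_iff\<close>)
  have "{} \<in> stable_sets V E" by (simp add: stable_sets_iff stable_def)
  then have "stability_number V E w \<in> (\<lambda>S. sum w S) ` stable_sets V E"
    unfolding stability_number_def using fin by (intro Max_in) auto
  then obtain S where "S \<in> stable_sets V E" "stability_number V E w = sum w S" by (rule imageE)
  then show "\<exists>S. S \<subseteq> V \<and> stable S \<and> sum w S = stability_number V E w"
    by (intro exI[of _ S]) (simp add: stable_sets_iff)
qed

lemma eval_indicator_graph_poly:
  assumes "finite V" "S \<subseteq> V" "stable S"
  shows "eval_indicator S (graph_poly V E w u) = real (sum w S)"
proof -
  have "eval_indicator S (\<Prod>i\<in>e. Var i) = 0" if e: "e \<in> E" for e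
  proof -
    from e obtain i j where ij: "e = {i, j}" "i \<noteq> j" by (rule edge_cases)
    with e assms(3) have "i \<notin> S \<or> j \<notin> S" by (auto simp: stable_def)
    then show ?thesis by (auto simp: ij eval_indicator_mult)
  qed
  then have "(\<Sum>e\<in>E. u e * eval_indicator S (\<Prod>i\<in>e. Var i)) = 0" by (simp add: sum.neutral)
  moreover have "(\<Sum>i\<in>V. real (w i) * of_bool (i \<in> S)) = real (sum w S)"
    using assms by (simp add: of_bool_def sum.If_cases Int_absorb1 if_distrib cong: if_cong)
  ultimately show ?thesis
    by (simp add: graph_poly_def eval_indicator_diff eval_indicator_sum eval_indicator_mult)
qed

text \<open>A certificate is evaluated at the indicator of a maximum weight stable set: the edge
  terms vanish there and the polynomial takes the value of the stability number.\<close>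

lemma p_han_ge_stability_number:
  assumes "finite V"
  shows "ereal (real (stability_number V E w)) \<le> p_han V E w u t"
proof -
  obtain S where S: "S \<subseteq> V" "stable S" "sum w S = stability_number V E w"
    using stability_number_attained[OF assms] by blast
  have "real (stability_number V E w) \<le> l"
    if "Const l - graph_poly V E w u \<in> handelman_set V t" for l
    using eval_indicator_handelman_set_nonneg[OF that, of S] eval_indicator_graph_poly[OF assms S(1,2)] S(3)
    by (simp add: eval_indicator_diff)
  then show ?thesis unfolding p_han_def by (auto intro!: INF_greatest)
qed

lemma cross_stable_le_fractional:
  assumes V: "finite V" "\<And>e. e \<in> E \<Longrightarrow> e \<subseteq> V"
    and XY: "X \<subseteq> V" "Y \<subseteq> V" "cross_stable adj X Y"
  shows "real (sum w X + sum w Y) \<le> 2 * fractional_stability_number V E w"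
proof -
  define x :: "'a \<Rightarrow> real" where "x i = (of_bool (i \<in> X) + of_bool (i \<in> Y)) / 2" for i
  \<comment> \<open>Boundedness of the polytope, which lets the supremum dominate every value: a
    non-isolated node is bounded through an edge, an isolated one by its explicit
    constraint.\<close>
  have ub: "z i \<le> 1" if z: "z \<in> FR V E" and i: "i \<in> V" for z i
  proof (cases "\<exists>e\<in>E. i \<in> e")
    case True
    then obtain e where e: "e \<in> E" "i \<in> e" by blast
    from e obtain j where j: "e = {i, j}" by (rule edge_at_cases)
    then have "{i, j} \<in> E" "j \<in> V" using V(2)[OF e(1)] e(1) by simp_all
    then have "z i + z j \<le> 1" "0 \<le> z j" using z unfolding FR_def by blast+
    then show ?thesis by simp
  next
    case False
    then show ?thesis using z i unfolding FR_def by blast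
  qed
  have "x \<in> FR V E"
    unfolding FR_def
  proof (intro CollectI conjI ballI allI impI)
    fix i j assume "{i, j} \<in> E"
    \<comment> \<open>The four indicators in \<open>x i + x j\<close> form two pairs, each with at
      most one indicator equal to 1.\<close>
    then have "\<not> (i \<in> X \<and> j \<in> Y)" "\<not> (j \<in> X \<and> i \<in> Y)"
      using XY(3) adj_sym unfolding cross_stable_def by blast+
    then show "x i + x j \<le> 1" unfolding x_def by (auto simp: of_bool_def)
  qed (auto simp: x_def)
  moreover have "bdd_above ((\<lambda>z. \<Sum>i\<in>V. real (w i) * z i) ` FR V E)"
    by (rule bdd_aboveI2[where M = "\<Sum>i\<in>V. real (w i)"])
       (auto intro!: sum_mono mult_left_le ub)
  ultimately have "(\<Sum>i\<in>V. real (w i) * x i) \<le> fractional_stability_number V E w"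
    unfolding fractional_stability_number_def by (intro cSUP_upper) auto
  moreover have "(\<Sum>i\<in>V. real (w i) * of_bool (i \<in> Z)) = real (sum w Z)" if "Z \<subseteq> V" for Z
    using V that by (simp add: of_bool_def sum.If_cases Int_absorb1 if_distrib cong: if_cong)
  from this[OF XY(1)] this[OF XY(2)]
  have "2 * (\<Sum>i\<in>V. real (w i) * x i) = real (sum w X + sum w Y)"
    by (simp add: x_def distrib_left sum.distrib flip: sum_divide_distrib)
  ultimately show ?thesis by linarith
qed

end

theorem corollary4:
  fixes V :: "'a set" and E :: "'a set set"
    and w :: "'a \<Rightarrow> nat" and u :: "'a set \<Rightarrow> real"
  assumes "finite_simple_graph V E"
    and "\<And>i j. {i, j} \<in> E \<Longrightarrow> u {i, j} \<ge> max (real (w i)) (real (w j))"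
  shows "ereal_of_enat (handelman_rank V E w u)
           \<le> ereal (2 * (fractional_stability_number V E w - real (stability_number V E w)) + 2)"
proof -
  interpret weighted_graph E w u
    by unfold_locales (use assms in \<open>auto simp: finite_simple_graph_def\<close>)
  have V: "finite V" "\<And>e. e \<in> E \<Longrightarrow> e \<subseteq> V"
    using assms(1) by (auto simp: finite_simple_graph_def)
  define l where "l = stability_number V E w"
  define k where "k = nat \<lfloor>2 * fractional_stability_number V E w\<rfloor>"
  define t where "t = k - 2 * l + 2"
  \<comment> \<open>Node weights are integers, so rounding down loses nothing.\<close>
  have k: "sum w X + sum w Y \<le> k" if "X \<subseteq> V" "Y \<subseteq> V" "cross_stable adj X Y" for X Y
    using cross_stable_le_fractional[OF V that] unfolding k_def by linarith
  obtain S where "S \<subseteq> V" "stable S" "sum w S = l"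
    using stability_number_attained[OF V(1)] l_def by blast
  \<comment> \<open>A maximum stable set taken twice is a cross-stable pair, so
    \<open>k - 2 * l\<close> is not truncated and can be carried over to the reals.\<close>
  with k[of S S] have lk: "2 * l \<le> k" by (simp add: stable_def cross_stable_def)
  \<comment> \<open>Nonnegativity ensures that \<open>nat\<close> does not raise the floor.\<close>
  have "0 \<le> 2 * fractional_stability_number V E w"
    using cross_stable_le_fractional[OF V, of "{}" "{}"] by (simp add: cross_stable_def)
  then have "real k \<le> 2 * fractional_stability_number V E w" unfolding k_def by linarith
  with lk have t: "real t \<le> 2 * (fractional_stability_number V E w - real l) + 2"
    by (simp add: t_def of_nat_diff)
  have "induced V = E" using V by (auto simp: induced_def)
  then have "Const (real l) - graph_poly V E w u \<in> handelman_set V t"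
    using cross_stable_bound_handelman[OF V(1), of l k] k stability_number_ge[OF V(1)]
    by (simp add: induced_poly_def t_def l_def)
  then have "p_han V E w u t \<le> ereal (real l)"
    unfolding p_han_def by (intro INF_lower) simp
  with p_han_ge_stability_number[OF V(1), of t] have "p_han V E w u t = ereal (real l)"
    by (simp add: l_def)
  then have "handelman_rank V E w u \<le> enat t"
    unfolding handelman_rank_def l_def by (intro INF_lower) (simp add: t_def)
  then have "ereal_of_enat (handelman_rank V E w u) \<le> ereal_of_enat (enat t)"
    by (simp only: ereal_of_enat_le_iff)
  also have "\<dots> \<le> ereal (2 * (fractional_stability_number V E w - real l) + 2)"
    using t by simp
  finally show ?thesis by (simp add: l_def)
qed

end
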